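(* For the complete graph $K_n$ on $n\ge 3$ vertices, $b_{\rm R}(K_n)=\lceil n/2\rceil$.
   Context: Graphs are finite, undirected, without loops or multiple edges; a graph is nonempty if it has at least one edge. A Roman dominating function on $G=(V,E)$ is a function $f:V\to\{0,1,2\}$ such that every vertex $x$ with $f(x)=0$ is adjacent to at least one vertex $y$ with $f(y)=2$. Its weight is $\sum_{u\in V}f(u)$. The Roman domination number $\gamma_{\rm R}(G)$ is the minimum weight of a Roman dominating function on $G$. The Roman bondage number of a nonempty graph $G$ is $b_{\rm R}(G)=\min\{|B|: B\subseteq E(G),\ \gamma_{\rm R}(G-B)>\gamma_{\rm R}(G)\}$, with $b_{\rm R}(G)=\infty$ if no such $B$ exists; here $G-B$ is obtained from $G$ by deleting the edges in $B$ (keeping all vertices). *)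

theory Defs
  imports Complex_Main "HOL-Library.Extended_Nat" "HOL-Library.FuncSet"
begin

record 'a ugraph =
  verts :: "'a set"
  edges :: "'a set set"

text \<open>
  An edge is a two-element set of vertices, so loops and multiple edges cannot occur, and
  the cardinality of an edge set counts undirected edges.
\<close>
definition simple_graph :: "'a ugraph \<Rightarrow> bool" where
  "simple_graph G \<longleftrightarrow> finite (verts G) \<and> edges G \<subseteq> {e. e \<subseteq> verts G \<and> card e = 2}"

definition adjacent :: "'a ugraph \<Rightarrow> 'a \<Rightarrow> 'a \<Rightarrow> bool" where
  "adjacent G x y \<longleftrightarrow> {x, y} \<in> edges G"

definition delete_edges :: "'a ugraph \<Rightarrow> 'a set set \<Rightarrow> 'a ugraph" where
  "delete_edges G B = \<lparr>verts = verts G, edges = edges G - B\<rparr>"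

definition complete_graph :: "'a set \<Rightarrow> 'a ugraph" where
  "complete_graph V = \<lparr>verts = V, edges = {e. e \<subseteq> V \<and> card e = 2}\<rparr>"

text \<open>The values of \<open>f\<close> outside the vertex set are irrelevant.\<close>
definition roman_dominating :: "'a ugraph \<Rightarrow> ('a \<Rightarrow> nat) \<Rightarrow> bool" where
  "roman_dominating G f \<longleftrightarrow>
     f \<in> verts G \<rightarrow> {0, 1, 2} \<and>
     (\<forall>x\<in>verts G. f x = 0 \<longrightarrow> (\<exists>y\<in>verts G. adjacent G x y \<and> f y = 2))"

definition weight :: "'a ugraph \<Rightarrow> ('a \<Rightarrow> nat) \<Rightarrow> nat" where
  "weight G f = (\<Sum>u\<in>verts G. f u)"

definition roman_domination_number :: "'a ugraph \<Rightarrow> nat" where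
  "roman_domination_number G = (LEAST w. \<exists>f. roman_dominating G f \<and> weight G f = w)"

text \<open>
  On \<^typ>\<open>enat\<close> the infimum of a nonempty set is its minimum, and the infimum of the empty
  set is \<open>\<infinity>\<close>.
\<close>
definition roman_bondage_number :: "'a ugraph \<Rightarrow> enat" where
  "roman_bondage_number G =
     Inf {enat (card B) | B. B \<subseteq> edges G \<and>
            roman_domination_number (delete_edges G B) > roman_domination_number G}"

lemma simple_graph_complete_graph: "finite V \<Longrightarrow> simple_graph (complete_graph V)"
  by (simp add: simple_graph_def complete_graph_def)

lemma simple_graph_delete_edges: "simple_graph G \<Longrightarrow> simple_graph (delete_edges G B)"
  by (auto simp: simple_graph_def delete_edges_def)

lemma roman_dominating_const_1: "roman_dominating G (\<lambda>_. 1)"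
  by (simp add: roman_dominating_def)

lemma roman_domination_number_attained:
  "\<exists>f. roman_dominating G f \<and> weight G f = roman_domination_number G"
  unfolding roman_domination_number_def
  by (rule LeastI_ex) (use roman_dominating_const_1 in blast)

end

theory Submission
  imports Defs
begin

text \<open>
  On at least three vertices a Roman dominating function of weight at most 2 must use the value 2,
  since otherwise every vertex has weight at least 1. That single 2 exhausts the weight, so all
  other vertices have value 0 and must be adjacent to the vertex of value 2. Hence the Roman
  domination number of such a graph is at least 2, and it equals 2 exactly when some vertex is adjacent to
  all others (\<open>roman_domination_number_le_2_iff\<close>). In particular it is 2 for the complete graph,
  and deleting an edge set \<open>B\<close> raises it exactly when every vertex loses an edge, that is, when
  \<open>B\<close> is an edge cover (\<open>delete_edges_complete_raises_iff\<close>). The Roman bondage number of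
  \<open>K\<^sub>n\<close> is therefore the least size of an edge cover of \<open>K\<^sub>n\<close>. An edge covers only two
  vertices, so this size is at least \<open>n/2\<close> (\<open>card_le_edge_cover\<close>), and joining the larger half of
  the vertices to the smaller one (\<open>small_edge_cover_exists\<close>) attains this bound, rounded up.
\<close>

lemma roman_domination_number_le:
  "roman_dominating G f \<Longrightarrow> roman_domination_number G \<le> weight G f"
  unfolding roman_domination_number_def by (rule Least_le) blast

text \<open>
  Were the value 2 absent, no vertex could have value 0 and the weight would be at least the number
  of vertices.
\<close>
lemma weight_le_2_dominator:
  assumes fin: "finite (verts G)" and card: "card (verts G) \<ge> 3"
    and f: "roman_dominating G f" and w: "weight G f \<le> 2"
  obtains v where "v \<in> verts G" "f v = 2" "\<And>u. u \<in> verts G - {v} \<Longrightarrow> adjacent G u v"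
proof -
  have "\<exists>v\<in>verts G. f v = 2"
  proof (rule ccontr)
    assume "\<not> ?thesis"
    then have "f u \<ge> 1" if "u \<in> verts G" for u
      using f that unfolding roman_dominating_def by (meson less_one linorder_not_le)
    then have "(\<Sum>u\<in>verts G. 1) \<le> weight G f"
      unfolding weight_def by (intro sum_mono)
    then show False using card w by simp
  qed
  then obtain v where v: "v \<in> verts G" "f v = 2" by blast
  have "weight G f = f v + (\<Sum>u\<in>verts G - {v}. f u)"
    unfolding weight_def using fin v(1) by (rule sum.remove)
  then have zero: "f u = 0" if "u \<in> verts G - {v}" for u
    using w v that fin by (simp add: sum_nonneg_eq_0_iff)
  have "adjacent G u v" if u: "u \<in> verts G - {v}" for u
  proof -
    obtain y where "y \<in> verts G" "adjacent G u y" "f y = 2"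
      using f zero[OF u] u unfolding roman_dominating_def by blast
    moreover from this have "y = v" using zero[of y] by fastforce
    ultimately show ?thesis by simp
  qed
  then show thesis using that v by blast
qed

lemma roman_domination_number_ge_2:
  assumes "finite (verts G)" "card (verts G) \<ge> 3"
  shows "roman_domination_number G \<ge> 2"
proof (rule ccontr)
  assume small: "\<not> ?thesis"
  obtain f where f: "roman_dominating G f" "weight G f = roman_domination_number G"
    using roman_domination_number_attained by blast
  obtain v where v: "v \<in> verts G" "f v = 2"
    using weight_le_2_dominator[OF assms f(1)] f(2) small by auto
  then have "f v \<le> weight G f"
    unfolding weight_def using assms(1) by (intro member_le_sum) auto
  then show False using v f small by simp
qed

lemma roman_domination_number_le_2_iff:
  assumes "finite (verts G)" "card (verts G) \<ge> 3"
  shows "roman_domination_number G \<le> 2 \<longleftrightarrow>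
    (\<exists>v\<in>verts G. \<forall>u\<in>verts G - {v}. adjacent G u v)"
proof
  assume le: "roman_domination_number G \<le> 2"
  obtain f where "roman_dominating G f" "weight G f = roman_domination_number G"
    using roman_domination_number_attained by blast
  with le show "\<exists>v\<in>verts G. \<forall>u\<in>verts G - {v}. adjacent G u v"
    using weight_le_2_dominator[OF assms] by metis
next
  assume "\<exists>v\<in>verts G. \<forall>u\<in>verts G - {v}. adjacent G u v"
  then obtain v where v: "v \<in> verts G" "\<forall>u\<in>verts G - {v}. adjacent G u v" by blast
  let ?f = "\<lambda>u. if u = v then 2 else 0 :: nat"
  have "roman_dominating G ?f" using v by (auto simp: roman_dominating_def)
  moreover have "weight G ?f = 2" using v(1) assms(1) by (simp add: weight_def)
  ultimately show "roman_domination_number G \<le> 2"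
    using roman_domination_number_le by metis
qed

lemma roman_domination_number_complete:
  assumes "finite V" "card V \<ge> 3"
  shows "roman_domination_number (complete_graph V) = 2"
proof (rule antisym)
  obtain v where "v \<in> V" using assms by fastforce
  then have "\<exists>v\<in>V. \<forall>u\<in>V - {v}. adjacent (complete_graph V) u v"
    by (intro bexI[of _ v]) (auto simp: adjacent_def complete_graph_def card_insert_if)
  then show "roman_domination_number (complete_graph V) \<le> 2"
    using roman_domination_number_le_2_iff[of "complete_graph V"] assms
    by (simp add: complete_graph_def)
qed (use roman_domination_number_ge_2[of "complete_graph V"] assms in \<open>simp add: complete_graph_def\<close>)

text \<open>
  A vertex of \<open>K\<^sub>n - B\<close> is adjacent to all others exactly when no edge of \<open>B\<close> contains it.
\<close>
lemma delete_edges_complete_raises_iff: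
  assumes "finite V" "card V \<ge> 3" and B: "B \<subseteq> edges (complete_graph V)"
  shows "roman_domination_number (delete_edges (complete_graph V) B)
           > roman_domination_number (complete_graph V) \<longleftrightarrow> V \<subseteq> \<Union>B"
proof -
  let ?G = "delete_edges (complete_graph V) B"
  have verts: "verts ?G = V" by (simp add: delete_edges_def complete_graph_def)
  have universal: "(\<forall>u\<in>V - {v}. adjacent ?G u v) \<longleftrightarrow> v \<notin> \<Union>B" if v: "v \<in> V" for v
  proof -
    have "adjacent ?G u v \<longleftrightarrow> {u, v} \<notin> B" if "u \<in> V - {v}" for u
      using that v by (auto simp: adjacent_def delete_edges_def complete_graph_def)
    moreover have "\<exists>u\<in>V - {v}. e = {u, v}" if "e \<in> B" "v \<in> e" for e
    proof -
      have e: "e \<subseteq> V" "card e = 2" using that B by (auto simp: complete_graph_def)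
      obtain x y where "e = {x, y}" "x \<noteq> y" using e(2) by (meson card_2_iff)
      then show ?thesis using e(1) \<open>v \<in> e\<close> by auto
    qed
    ultimately show ?thesis by blast
  qed
  have "roman_domination_number ?G \<le> 2 \<longleftrightarrow> (\<exists>v\<in>V. v \<notin> \<Union>B)"
    using roman_domination_number_le_2_iff[of ?G] assms universal unfolding verts by simp
  then show ?thesis
    using roman_domination_number_complete[OF assms(1,2)] by (auto simp: not_le[symmetric])
qed

lemma card_le_edge_cover:
  assumes "finite B" and two: "\<And>e. e \<in> B \<Longrightarrow> card e = 2" and "V \<subseteq> \<Union>B"
  shows "card V \<le> 2 * card B"
proof -
  have "finite (\<Union>B)" using assms(1) two by (metis card.infinite finite_Union zero_neq_numeral)
  then have "card V \<le> card (\<Union>B)" using assms(3) by (intro card_mono)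
  also have "\<dots> \<le> (\<Sum>e\<in>B. card e)" using two by (intro card_Union_le_sum_card)
  also have "\<dots> = 2 * card B" using two by simp
  finally show ?thesis .
qed

text \<open>
  The larger half \<open>A\<close> of \<open>V\<close> maps onto the rest by some \<open>g\<close>; the edges \<open>{x, g x}\<close> with
  \<open>x \<in> A\<close> reach every vertex, and there are at most as many of them as elements of \<open>A\<close>.
\<close>
lemma small_edge_cover_exists:
  assumes "finite V" "card V \<ge> 2"
  obtains B where "B \<subseteq> edges (complete_graph V)" "V \<subseteq> \<Union>B" "card B \<le> (card V + 1) div 2"
proof -
  have "(card V + 1) div 2 \<le> card V" using assms(2) by linarith
  then obtain A where A: "A \<subseteq> V" "card A = (card V + 1) div 2" "finite A"
    by (rule obtain_subset_with_card_n)
  have rest: "card (V - A) = card V - card A" using A by (simp add: card_Diff_subset)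
  have "card (V - A) > 0" using rest A(2) assms(2) by linarith
  then have "V - A \<noteq> {}" by (metis card.empty less_irrefl)
  moreover have "\<exists>h. inj_on h (V - A) \<and> h ` (V - A) \<subseteq> A"
    proof -
    have "card (V - A) \<le> card A" using rest A(2) by linarith
    then show ?thesis using card_le_inj[of "V - A" A] A(3) assms(1) by blast
  qed
  ultimately obtain g where g: "g ` A = V - A" using inj_on_iff_surj by metis
  show thesis
  proof
    show "(\<lambda>x. {x, g x}) ` A \<subseteq> edges (complete_graph V)"
    proof
      fix e assume "e \<in> (\<lambda>x. {x, g x}) ` A"
      then obtain x where x: "x \<in> A" "e = {x, g x}" by blast
      moreover have "g x \<in> V - A" using g x by blast
      moreover from this have "x \<noteq> g x" using x by auto
      ultimately show "e \<in> edges (complete_graph V)"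
        using A by (auto simp: complete_graph_def)
    qed
    show "V \<subseteq> \<Union>((\<lambda>x. {x, g x}) ` A)" using g by blast
    show "card ((\<lambda>x. {x, g x}) ` A) \<le> (card V + 1) div 2"
      using card_image_le[OF A(3)] A(2) by metis
  qed
qed

theorem corollary3p1:
  fixes V :: "'a set" and n :: nat
  assumes "finite V" and "card V = n" and "n \<ge> 3"
  shows "roman_bondage_number (complete_graph V) = enat (nat \<lceil>real n / 2\<rceil>)"
proof -
  have raises: "roman_domination_number (delete_edges (complete_graph V) B)
      > roman_domination_number (complete_graph V) \<longleftrightarrow> V \<subseteq> \<Union>B"
    if "B \<subseteq> edges (complete_graph V)" for B
    using delete_edges_complete_raises_iff[OF _ _ that] assms by blast
  have lower: "(n + 1) div 2 \<le> card B"
    if "B \<subseteq> edges (complete_graph V)" "V \<subseteq> \<Union>B" for B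
  proof -
    have "edges (complete_graph V) \<subseteq> Pow V" by (auto simp: complete_graph_def)
    then have "finite B" using that(1) assms(1) by (meson finite_Pow_iff finite_subset)
    moreover have "card e = 2" if "e \<in> B" for e
      using that \<open>B \<subseteq> edges (complete_graph V)\<close> by (auto simp: complete_graph_def)
    ultimately show ?thesis using card_le_edge_cover[of B V] that(2) assms(2) by auto
  qed
  obtain C where C: "C \<subseteq> edges (complete_graph V)" "V \<subseteq> \<Union>C" "card C \<le> (n + 1) div 2"
    using small_edge_cover_exists[of V] assms by auto
  have "roman_bondage_number (complete_graph V)
      = Inf {enat (card B) | B. B \<subseteq> edges (complete_graph V) \<and> V \<subseteq> \<Union>B}"
    unfolding roman_bondage_number_def using raises by (simp cong: conj_cong)
  also have "\<dots> = enat ((n + 1) div 2)"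
  proof (rule antisym)
    have "card C = (n + 1) div 2" using C lower by (simp add: le_antisym)
    then have "enat ((n + 1) div 2)
        \<in> {enat (card B) | B. B \<subseteq> edges (complete_graph V) \<and> V \<subseteq> \<Union>B}"
      using C(1,2) by (intro CollectI exI[of _ C]) simp
    then show "Inf {enat (card B) | B. B \<subseteq> edges (complete_graph V) \<and> V \<subseteq> \<Union>B}
        \<le> enat ((n + 1) div 2)"
      by (rule Inf_lower)
    show "enat ((n + 1) div 2)
        \<le> Inf {enat (card B) | B. B \<subseteq> edges (complete_graph V) \<and> V \<subseteq> \<Union>B}"
    proof (rule Inf_greatest, clarify)
      fix B assume "B \<subseteq> edges (complete_graph V)" "V \<subseteq> \<Union>B"
      then show "enat ((n + 1) div 2) \<le> enat (card B)" using lower by simp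
    qed
  qed
  also have "(n + 1) div 2 = nat \<lceil>real n / 2\<rceil>" by linarith
  finally show ?thesis .
qed

end
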